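(* Let $\mathcal{J}: H^1(\Omega,M)\to\mathbb{R}$ be a sufficiently smooth energy functional, let $V_h^M$ be the geometric finite element space, and let $J:\mathcal{M}\to\mathbb{R}$, $J(\bar v) := \mathcal{J}(\mathcal{E}^{-1}(\bar v))$. For $\bar v\in\mathcal{M}\subset M^n$, the following two problems are equivalent: $$dJ[\bar v](\bar\eta)=0 \qquad \forall\,\bar\eta\in T_{\bar v}M^n,$$ and $$d\mathcal{J}[\mathcal{E}^{-1}(\bar v)](\mathcal{T}(\bar\eta))=0 \qquad \forall\,\bar\eta\in T_{\bar v}M^n .$$ That is, $\bar v$ satisfies the first condition if and only if it satisfies the second.
   Context: Manifold and Sobolev space. $M$ is a smooth connected Riemannian manifold with an isometric embedding $\imath: M\to\mathbb{R}^N$. $\Omega\subset\mathbb{R}^d$ is an open, connected, bounded domain with polygonal (Lipschitz) boundary. $H^1(\Omega,M)$ is the set of $v\in H^1(\Omega,\mathbb{R}^N)$ with $v(x)\in\imath(M)$ for a.e. $x$. Interpolation on a reference element. $T_{\mathrm{ref}}\subset\mathbb{R}^d$ is a bounded domain with distinct Lagrange nodes $a_1,\dots,a_m\in\overline{T_{\mathrm{ref}}}$ and scalar Lagrange shape functions $\varphi_1,\dots,\varphi_m$ (polynomials of order $p$, $\varphi_i(a_j)=\delta_{ij}$, with unique solvability of the scalar interpolation problem in their span). For $v=(v_1,\dots,v_m)\in M^m$, $\Upsilon(v;\xi)$ is either geodesic interpolation ($M$ complete, $\operatorname{dist}$ the Riemannian distance), $$\Upsilon^{\mathrm{ge}}(v,\xi):=\operatorname*{arg\,min}_{q\in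 M}\sum_{i=1}^m\varphi_i(\xi)\operatorname{dist}(v_i,q)^2,$$ or projection-based interpolation, $$\Upsilon^{\mathrm{pr}}(v,\xi):=\mathcal{P}\Big[\sum_{i=1}^m\varphi_i(\xi)\,\imath(v_i)\Big],$$ where $\mathcal{P}$ is a differentiable projection from a neighborhood of $\imath(M)$ in $\mathbb{R}^N$ onto $M$ (so $\mathcal{P}(\imath(q))=q$). The same choice is used throughout. Geometric finite element space. $\mathcal{G}$ is a conforming grid of $\Omega$, and $x_1,\dots,x_n$ are all Lagrange nodes of its elements. $V_h^M$ is the set of continuous $v_h:\Omega\to M$ such that on each element $T\in\mathcal{G}$ one has $v_h|_T(x)=\Upsilon(v_{T,1},\dots,v_{T,m};\mathcal{F}_T(x))$ with values $v_{T,i}\in M$, where $\mathcal{F}_T:T\to T_{\mathrm{ref}}$ is affine or multilinear and $T_{\mathrm{ref}}$ is the reference element corresponding to $T$ (node numbers, shape functions and $m$ may depend on the element type). It is known that $V_h^M\subset H^1(\Omega,M)$. Nodal evaluation and algebraic space. $\mathcal{E}:V_h^M\to M^n$, $(\mathcal{E}(v_h))_i=v_h(x_i)$. Let $\widetilde{\mathcal{M}}\subset M^n$ be the set of all $\bar v$ for which $\mathcal{E}^{-1}$ is defined and single-valued at $\bar v$ (exactly one $v_h\in V_h^M$ has $\mathcal{E}(v_h)=\bar v$), and let $\mathcal{M}:=\operatorname{int}\widetilde{\mathcal{M}}$, an open submanifold of $M^n$. So $T_{\bar v}\mathcal{M}=T_{\bar v}M^n=\prod_{i=1}^nT_{v_i}M$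 for $\bar v = (v_1,\dots,v_n)\in\mathcal{M}$. Standing assumption. Near the coefficients $\bar v\in\mathcal{M}$ considered, the interpolation $\Upsilon$ on each element is single-valued and depends differentiably ($C^1$) on its nodal values, and $V_h^M$ near $\mathcal{E}^{-1}(\bar v)$ carries the differentiable manifold structure inherited from $\mathcal{M}$ via $\mathcal{E}$: a curve $c$ in $V_h^M$ is differentiable if and only if $c=\mathcal{E}^{-1}\circ C$ for a differentiable curve $C$ in $\mathcal{M}$. Test functions. For $v_h\in V_h^M$, $T_{v_h}V_h^M$ is the space of test functions along $v_h$: continuous vector fields $\eta_h$ along $v_h$ ($\eta_h(x)\in T_{v_h(x)}M$) whose restriction to each element $T$ is a variation of the interpolation function $v_h|_T$, i.e. the pointwise derivative at $t=0$ of a differentiable curve of interpolation functions (differentiable in the nodal values) passing through $v_h|_T$ at $t=0$. Equivalently, they are the pointwise derivatives $\dot c(0)$ of differentiable curves $c$ in $V_h^M$ with $c(0)=v_h$. For $\bar v\in\mathcal{M}$, $v_h=\mathcal{E}^{-1}(\bar v)$, the operator $\mathcal{T}: T_{\bar v}M^n\to T_{v_h}V_h^M$ sends $\bar\eta=(\bar\eta_1,\dots,\bar\eta_n)$ to the vector field given on each element $T$ by $$\mathcal{T}(\bar\eta)(x)=\sum_{k=1}^m\frac{\partial\Upsilon(v_{T,1},\dots,v_{T,m};\mathcal{F}_T(x))}{\partial v_k}\cdot b_{T,k},$$ where $v_{T,k}$ and $b_{T,k}$ are the entries of $\bar v$ and $\bar\eta$ belonging to the $k$-th Lagrange node of $T$.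 Derivatives. "Sufficiently smooth" means that the restriction of $\mathcal{J}$ to $V_h^M$ is differentiable at the functions considered. $d\mathcal{J}[v_h](\eta_h)$ is the derivative of $\mathcal{J}$ at $v_h$ in the direction of the test function $\eta_h\in T_{v_h}V_h^M$, i.e. $\frac{d}{dt}\mathcal{J}(c(t))|_{t=0}$ for a differentiable curve $c$ in $V_h^M$ with $c(0)=v_h$ and $\dot c(0)=\eta_h$. $dJ[\bar v](\bar\eta)$ is the usual differential of $J$ on the manifold $\mathcal{M}$. *)

theory Defs
  imports "HOL-Analysis.Analysis"
begin

section \<open>Smooth maps, embedded submanifolds, Riemannian distance\<close>

text \<open>On open sets \<open>S\<close> this is the usual class of \<open>k\<close> times continuously differentiable maps.\<close>

primrec Ck_on :: "nat \<Rightarrow> 'a::euclidean_space set \<Rightarrow> ('a \<Rightarrow> 'b::real_normed_vector) \<Rightarrow> bool" where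
  "Ck_on 0 S f \<longleftrightarrow> continuous_on S f"
| "Ck_on (Suc k) S f \<longleftrightarrow> (\<forall>x\<in>S. f differentiable (at x)) \<and>
     (\<forall>b\<in>Basis. Ck_on k S (\<lambda>x. frechet_derivative f (at x) b))"

definition smooth_on :: "'a::euclidean_space set \<Rightarrow> ('a \<Rightarrow> 'b::real_normed_vector) \<Rightarrow> bool" where
  "smooth_on S f \<longleftrightarrow> (\<forall>k. Ck_on k S f)"

text \<open>A Riemannian manifold with an isometric embedding into \<open>R^N\<close> is identified with the image
  of the embedding: \<open>M\<close> is a subset of \<open>R^N\<close> which is an embedded smooth submanifold, the
  embedding is the inclusion, and topology, smooth structure and metric of \<open>M\<close> are the
  induced ones. Accordingly tangent vectors are vectors of \<open>R^N\<close>.\<close>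

definition smooth_submanifold :: "'a::euclidean_space set \<Rightarrow> bool" where
  "smooth_submanifold M \<longleftrightarrow>
     (\<exists>k. \<forall>p\<in>M. \<exists>U V \<Phi> \<Psi> (L :: 'a set).
        open U \<and> p \<in> U \<and> open V \<and> homeomorphism U V \<Phi> \<Psi> \<and> smooth_on U \<Phi> \<and> smooth_on V \<Psi> \<and>
        subspace L \<and> dim L = k \<and> \<Phi> ` (U \<inter> M) = V \<inter> L)"

definition curve_length :: "(real \<Rightarrow> 'a::euclidean_space) \<Rightarrow> real" where
  "curve_length \<gamma> = integral {0..1} (\<lambda>t. norm (vector_derivative \<gamma> (at t)))"

text \<open>The library notion of a piecewise \<open>C^1\<close> curve allows the derivative to be unbounded near the
  exceptional points. Curves of infinite length have to be excluded explicitly, because the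
  integral of a non-integrable function is \<open>0\<close>.\<close>

definition riem_dist :: "'a::euclidean_space set \<Rightarrow> 'a \<Rightarrow> 'a \<Rightarrow> real" where
  "riem_dist M p q = Inf {curve_length \<gamma> |\<gamma>. \<gamma> piecewise_C1_differentiable_on {0..1} \<and>
     (\<lambda>t. norm (vector_derivative \<gamma> (at t))) integrable_on {0..1} \<and>
     \<gamma> ` {0..1} \<subseteq> M \<and> \<gamma> 0 = p \<and> \<gamma> 1 = q}"

definition diff_curve :: "real \<Rightarrow> 'a::real_normed_vector set \<Rightarrow> (real \<Rightarrow> 'a) \<Rightarrow> bool" where
  "diff_curve \<epsilon> A C \<longleftrightarrow> 0 < \<epsilon> \<and> (\<forall>t\<in>{-\<epsilon><..<\<epsilon>}. C t \<in> A \<and> C differentiable (at t))"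

definition tangent_space :: "'a::real_normed_vector set \<Rightarrow> 'a \<Rightarrow> 'a set" where
  "tangent_space M q =
     {w. \<exists>\<epsilon> \<gamma>. diff_curve \<epsilon> M \<gamma> \<and> \<gamma> 0 = q \<and> (\<gamma> has_vector_derivative w) (at 0)}"

definition Mpow :: "'a set \<Rightarrow> ('a ^ 'k::finite) set" where
  "Mpow M = {v. \<forall>i. v $ i \<in> M}"

definition tangent_Mpow :: "'a::real_normed_vector set \<Rightarrow> 'a ^ 'k::finite \<Rightarrow> ('a ^ 'k) set" where
  "tangent_Mpow M v = {b. \<forall>i. b $ i \<in> tangent_space M (v $ i)}"

text \<open>For maps on a subset \<open>A\<close> of a Euclidean space (below, an open part of a power of \<open>M\<close>),
  continuous differentiability means that the map is locally the restriction of a \<open>C^1\<close> map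
  on an open set.\<close>

definition C1_on_submanifold ::
    "'a::euclidean_space set \<Rightarrow> ('a \<Rightarrow> 'b::real_normed_vector) \<Rightarrow> bool" where
  "C1_on_submanifold A f \<longleftrightarrow>
     (\<forall>v\<in>A. \<exists>U g. open U \<and> v \<in> U \<and> Ck_on 1 U g \<and> (\<forall>w\<in>U \<inter> A. g w = f w))"

section \<open>The domain and the Sobolev space\<close>

definition lipschitz_boundary :: "'a::euclidean_space set \<Rightarrow> bool" where
  "lipschitz_boundary \<Omega> \<longleftrightarrow>
     (\<forall>p\<in>frontier \<Omega>. \<exists>U e L \<gamma>. open U \<and> p \<in> U \<and> norm e = 1 \<and> L-lipschitz_on UNIV \<gamma> \<and>
        U \<inter> \<Omega> = {x\<in>U. \<gamma> (x - (x \<bullet> e) *\<^sub>R e) < x \<bullet> e})"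

definition polygonal :: "'a::euclidean_space set \<Rightarrow> bool" where
  "polygonal \<Omega> \<longleftrightarrow> (\<exists>P. finite P \<and> (\<forall>C\<in>P. polytope C) \<and> closure \<Omega> = \<Union>P)"

definition test_function :: "(real ^ 'd::finite) set \<Rightarrow> (real ^ 'd \<Rightarrow> real) \<Rightarrow> bool" where
  "test_function \<Omega> \<phi> \<longleftrightarrow>
     smooth_on UNIV \<phi> \<and> compact (closure {x. \<phi> x \<noteq> 0}) \<and> closure {x. \<phi> x \<noteq> 0} \<subseteq> \<Omega>"

definition L2_on :: "(real ^ 'd::finite) set \<Rightarrow> (real ^ 'd \<Rightarrow> real ^ 'N::finite) \<Rightarrow> bool" where
  "L2_on \<Omega> f \<longleftrightarrow> f \<in> borel_measurable (lebesgue_on \<Omega>) \<and>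
     integrable (lebesgue_on \<Omega>) (\<lambda>x. (norm (f x))\<^sup>2)"

definition weak_partial ::
    "(real ^ 'd::finite) set \<Rightarrow> 'd \<Rightarrow> (real ^ 'd \<Rightarrow> real ^ 'N::finite) \<Rightarrow> (real ^ 'd \<Rightarrow> real ^ 'N) \<Rightarrow> bool"
where
  "weak_partial \<Omega> j f g \<longleftrightarrow>
     (\<forall>\<phi>. test_function \<Omega> \<phi> \<longrightarrow>
        (LINT x|lebesgue_on \<Omega>. frechet_derivative \<phi> (at x) (axis j 1) *\<^sub>R f x) =
        - (LINT x|lebesgue_on \<Omega>. \<phi> x *\<^sub>R g x))"

text \<open>Representatives rather than almost-everywhere classes; values outside \<open>\<Omega>\<close> are irrelevant.\<close>

definition H1 :: "(real ^ 'd::finite) set \<Rightarrow> (real ^ 'd \<Rightarrow> real ^ 'N::finite) set" where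
  "H1 \<Omega> = {f. L2_on \<Omega> f \<and> (\<forall>j. \<exists>g. L2_on \<Omega> g \<and> weak_partial \<Omega> j f g)}"

definition H1_into ::
    "(real ^ 'd::finite) set \<Rightarrow> (real ^ 'N::finite) set \<Rightarrow> (real ^ 'd \<Rightarrow> real ^ 'N) set" where
  "H1_into \<Omega> M = {f \<in> H1 \<Omega>. AE x in lebesgue_on \<Omega>. f x \<in> M}"

text \<open>A functional on \<open>H^1(\<Omega>,M)\<close> depends only on the almost-everywhere class.\<close>

definition functional_on_H1_into ::
    "(real ^ 'd::finite) set \<Rightarrow> (real ^ 'N::finite) set \<Rightarrow> ((real ^ 'd \<Rightarrow> real ^ 'N) \<Rightarrow> real) \<Rightarrow> bool"
where
  "functional_on_H1_into \<Omega> M \<J> \<longleftrightarrow>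
     (\<forall>f\<in>H1_into \<Omega> M. \<forall>g\<in>H1_into \<Omega> M. (AE x in lebesgue_on \<Omega>. f x = g x) \<longrightarrow> \<J> f = \<J> g)"

section \<open>Reference elements and interpolation\<close>

text \<open>Local node numbers are the elements of the subset \<open>ref_idx\<close> of a finite type \<open>'m\<close>, so that
  the number of nodes can differ between reference elements. Tuples of local values have type
  \<open>(real ^ 'N) ^ 'm\<close>; their entries outside \<open>ref_idx\<close> are never used.\<close>

record ('d, 'm) ref_element =
  ref_dom :: "(real ^ 'd::finite) set"
  ref_idx :: "'m set"
  ref_node :: "'m \<Rightarrow> real ^ 'd"
  ref_shape :: "'m \<Rightarrow> real ^ 'd \<Rightarrow> real"

text \<open>The order bounds the degree in each variable separately, which covers the usual spaces on
  simplices (total degree) as well as on cubes and prisms.\<close>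

definition polynomial_of_order :: "nat \<Rightarrow> (real ^ 'd::finite \<Rightarrow> real) \<Rightarrow> bool" where
  "polynomial_of_order p f \<longleftrightarrow>
     (\<exists>c. \<forall>x. f x = (\<Sum>\<alpha> | \<forall>i. \<alpha> i \<le> p. c \<alpha> * (\<Prod>i\<in>UNIV. (x $ i) ^ \<alpha> i)))"

text \<open>The Kronecker property makes scalar interpolation in the span of the shape functions
  uniquely solvable.\<close>

definition lagrange_element :: "nat \<Rightarrow> ('d::finite, 'm::finite) ref_element \<Rightarrow> bool" where
  "lagrange_element p R \<longleftrightarrow>
     open (ref_dom R) \<and> connected (ref_dom R) \<and> bounded (ref_dom R) \<and> ref_dom R \<noteq> {} \<and>
     ref_idx R \<noteq> {} \<and> inj_on (ref_node R) (ref_idx R) \<and>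
     ref_node R ` ref_idx R \<subseteq> closure (ref_dom R) \<and>
     (\<forall>i\<in>ref_idx R. polynomial_of_order p (ref_shape R i)) \<and>
     (\<forall>i\<in>ref_idx R. \<forall>j\<in>ref_idx R. ref_shape R i (ref_node R j) = (if i = j then 1 else 0))"

text \<open>\<open>Projection U P\<close>: a projection \<open>P\<close> defined on the neighbourhood \<open>U\<close> of \<open>M\<close>.\<close>

datatype 'a interpolation_rule = Geodesic | Projection "'a set" "'a \<Rightarrow> 'a"

fun admissible_rule :: "'a::euclidean_space set \<Rightarrow> 'a interpolation_rule \<Rightarrow> bool" where
  "admissible_rule M Geodesic \<longleftrightarrow> Metric_space.mcomplete M (riem_dist M)"
| "admissible_rule M (Projection U P) \<longleftrightarrow>
     open U \<and> M \<subseteq> U \<and> P differentiable_on U \<and> P ` U = M \<and> (\<forall>q\<in>M. P q = q)"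

text \<open>\<open>q\<close> is a value of the interpolation of \<open>w\<close> at \<open>\<xi>\<close>. This is a relation because a minimizer
  may fail to exist or to be unique, and the projection is only defined near \<open>M\<close>.\<close>

fun interpolates ::
    "(real ^ 'N::finite) set \<Rightarrow> (real ^ 'N) interpolation_rule \<Rightarrow> ('d::finite, 'm::finite) ref_element
     \<Rightarrow> (real ^ 'N) ^ 'm \<Rightarrow> real ^ 'd \<Rightarrow> real ^ 'N \<Rightarrow> bool"
where
  "interpolates M Geodesic R w \<xi> q \<longleftrightarrow>
     is_arg_min (\<lambda>q. \<Sum>i\<in>ref_idx R. ref_shape R i \<xi> * (riem_dist M (w $ i) q)\<^sup>2) (\<lambda>q. q \<in> M) q"
| "interpolates M (Projection U P) R w \<xi> q \<longleftrightarrow>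
     (let y = (\<Sum>i\<in>ref_idx R. ref_shape R i \<xi> *\<^sub>R (w $ i)) in y \<in> U \<and> q = P y)"

section \<open>Geometric finite elements\<close>

text \<open>The grid elements are closed sets covering the closure of \<open>\<Omega>\<close>; finite element functions live
  on this closure, because Lagrange nodes may lie on the boundary.\<close>

record ('d, 'N, 'n, 'm) gfe =
  mfd :: "(real ^ 'N::finite) set"
  dom\<Omega> :: "(real ^ 'd::finite) set"
  rule :: "(real ^ 'N) interpolation_rule"
  order :: nat
  grid :: "(real ^ 'd) set set"
  ref :: "(real ^ 'd) set \<Rightarrow> ('d, 'm::finite) ref_element"
  ref_map :: "(real ^ 'd) set \<Rightarrow> real ^ 'd \<Rightarrow> real ^ 'd"
  node :: "'n::finite \<Rightarrow> real ^ 'd"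

text \<open>Affine in each coordinate separately: the ``multilinear'' maps of finite element theory,
  with the affine maps as a special case.\<close>

definition multiaffine :: "(real ^ 'd::finite \<Rightarrow> real ^ 'd) \<Rightarrow> bool" where
  "multiaffine f \<longleftrightarrow> (\<forall>x j. \<exists>a b. \<forall>t. f (x + t *\<^sub>R axis j 1) = a + t *\<^sub>R b)"

text \<open>Either the map to the reference element or the map from it may be multilinear; for affine
  maps this makes no difference.\<close>

definition element_map ::
    "(real ^ 'd::finite) set \<Rightarrow> (real ^ 'd) set \<Rightarrow> (real ^ 'd \<Rightarrow> real ^ 'd) \<Rightarrow> bool" where
  "element_map T R F \<longleftrightarrow>
     (\<exists>G. homeomorphism T (closure R) F G \<and>
        (\<exists>f. multiaffine f \<and> ((\<forall>x\<in>T. f x = F x) \<or> (\<forall>\<xi>\<in>closure R. f \<xi> = G \<xi>))))"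

text \<open>Conformity: two different elements meet in a common (possibly empty) face, where the faces of
  \<open>T\<close> correspond to the faces of the reference element under the element map.\<close>

definition conforming_grid :: "('d::finite, 'N::finite, 'n::finite, 'm::finite) gfe \<Rightarrow> bool" where
  "conforming_grid S \<longleftrightarrow>
     finite (grid S) \<and> \<Union>(grid S) = closure (dom\<Omega> S) \<and>
     (\<forall>T\<in>grid S. lagrange_element (order S) (ref S T) \<and>
        element_map T (ref_dom (ref S T)) (ref_map S T)) \<and>
     (\<forall>T\<in>grid S. \<forall>T'\<in>grid S. T \<noteq> T' \<longrightarrow>
        interior T \<inter> interior T' = {} \<and>
        (\<exists>f f'. f face_of closure (ref_dom (ref S T)) \<and> f' face_of closure (ref_dom (ref S T')) \<and>
           T \<inter> T' = {x\<in>T. ref_map S T x \<in> f} \<and> T \<inter> T' = {x\<in>T'. ref_map S T' x \<in> f'}))"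

definition gfe_setting :: "('d::finite, 'N::finite, 'n::finite, 'm::finite) gfe \<Rightarrow> bool" where
  "gfe_setting S \<longleftrightarrow>
     smooth_submanifold (mfd S) \<and> connected (mfd S) \<and> admissible_rule (mfd S) (rule S) \<and>
     open (dom\<Omega> S) \<and> connected (dom\<Omega> S) \<and> bounded (dom\<Omega> S) \<and> dom\<Omega> S \<noteq> {} \<and>
     polygonal (dom\<Omega> S) \<and> lipschitz_boundary (dom\<Omega> S) \<and>
     conforming_grid S \<and> inj (node S) \<and>
     range (node S) =
       (\<Union>T\<in>grid S. {x\<in>T. ref_map S T x \<in> ref_node (ref S T) ` ref_idx (ref S T)})"

text \<open>Index of the global node that is the \<open>k\<close>-th Lagrange node of \<open>T\<close>.\<close>

definition global_idx ::
    "('d::finite, 'N::finite, 'n::finite, 'm::finite) gfe \<Rightarrow> (real ^ 'd) set \<Rightarrow> 'm \<Rightarrow> 'n" where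
  "global_idx S T k = (THE i. node S i \<in> T \<and> ref_map S T (node S i) = ref_node (ref S T) k)"

definition local_values ::
    "('d::finite, 'N::finite, 'n::finite, 'm::finite) gfe \<Rightarrow> (real ^ 'd) set \<Rightarrow>
     (real ^ 'N) ^ 'n \<Rightarrow> (real ^ 'N) ^ 'm" where
  "local_values S T v = (\<chi> k. v $ global_idx S T k)"

definition Vh :: "('d::finite, 'N::finite, 'n::finite, 'm::finite) gfe \<Rightarrow> (real ^ 'd \<Rightarrow> real ^ 'N) set"
where
  "Vh S = {u. u \<in> closure (dom\<Omega> S) \<rightarrow>\<^sub>E mfd S \<and> continuous_on (closure (dom\<Omega> S)) u \<and>
     (\<forall>T\<in>grid S. \<exists>w \<in> Mpow (mfd S). \<forall>x\<in>T.
        interpolates (mfd S) (rule S) (ref S T) w (ref_map S T x) (u x))}"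

definition eval_nodes ::
    "('d::finite, 'N::finite, 'n::finite, 'm::finite) gfe \<Rightarrow> (real ^ 'd \<Rightarrow> real ^ 'N) \<Rightarrow> (real ^ 'N) ^ 'n"
where
  "eval_nodes S u = (\<chi> i. u (node S i))"

definition alg_space_tilde ::
    "('d::finite, 'N::finite, 'n::finite, 'm::finite) gfe \<Rightarrow> ((real ^ 'N) ^ 'n) set" where
  "alg_space_tilde S = {v \<in> Mpow (mfd S). \<exists>!u. u \<in> Vh S \<and> eval_nodes S u = v}"

definition alg_space ::
    "('d::finite, 'N::finite, 'n::finite, 'm::finite) gfe \<Rightarrow> ((real ^ 'N) ^ 'n) set" where
  "alg_space S = (top_of_set (Mpow (mfd S))) interior_of (alg_space_tilde S)"

definition eval_inv ::
    "('d::finite, 'N::finite, 'n::finite, 'm::finite) gfe \<Rightarrow> (real ^ 'N) ^ 'n \<Rightarrow> (real ^ 'd \<Rightarrow> real ^ 'N)"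
where
  "eval_inv S v = (THE u. u \<in> Vh S \<and> eval_nodes S u = v)"

definition interp ::
    "('d::finite, 'N::finite, 'n::finite, 'm::finite) gfe \<Rightarrow> (real ^ 'd) set \<Rightarrow>
     (real ^ 'N) ^ 'm \<Rightarrow> real ^ 'd \<Rightarrow> real ^ 'N" where
  "interp S T w \<xi> = (THE q. interpolates (mfd S) (rule S) (ref S T) w \<xi> q)"

definition regular_interpolation ::
    "('d::finite, 'N::finite, 'n::finite, 'm::finite) gfe \<Rightarrow> (real ^ 'N) ^ 'n \<Rightarrow> bool" where
  "regular_interpolation S v \<longleftrightarrow>
     (\<forall>T\<in>grid S. \<exists>W. open W \<and> local_values S T v \<in> W \<and>
        (\<forall>\<xi>\<in>closure (ref_dom (ref S T)).
           (\<forall>w \<in> W \<inter> Mpow (mfd S). \<exists>!q. interpolates (mfd S) (rule S) (ref S T) w \<xi> q) \<and>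
           C1_on_submanifold (W \<inter> Mpow (mfd S)) (\<lambda>w. interp S T w \<xi>)))"

section \<open>Differentials\<close>

text \<open>For a map on an embedded submanifold \<open>A\<close>, being differentiable as a map on the manifold is the
  same as having a Frechet derivative within \<open>A\<close>. That derivative is unique on tangent vectors
  of \<open>A\<close>, where it is the manifold differential; it is only applied to such vectors here.\<close>

definition partial_interp ::
    "('d::finite, 'N::finite, 'n::finite, 'm::finite) gfe \<Rightarrow> (real ^ 'd) set \<Rightarrow> 'm \<Rightarrow>
     (real ^ 'N) ^ 'm \<Rightarrow> real ^ 'd \<Rightarrow> real ^ 'N \<Rightarrow> real ^ 'N" where
  "partial_interp S T k w \<xi> =
     frechet_derivative (\<lambda>q. interp S T (\<chi> j. if j = k then q else w $ j) \<xi>) (at (w $ k) within mfd S)"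

definition test_fun_op ::
    "('d::finite, 'N::finite, 'n::finite, 'm::finite) gfe \<Rightarrow> (real ^ 'N) ^ 'n \<Rightarrow> (real ^ 'N) ^ 'n \<Rightarrow>
     (real ^ 'd \<Rightarrow> real ^ 'N)" where
  "test_fun_op S v b =
     (THE \<eta>. \<eta> \<in> extensional (closure (dom\<Omega> S)) \<and>
        (\<forall>T\<in>grid S. \<forall>x\<in>T. \<eta> x =
           (\<Sum>k\<in>ref_idx (ref S T).
              partial_interp S T k (local_values S T v) (ref_map S T x) (local_values S T b $ k))))"

definition alg_energy ::
    "('d::finite, 'N::finite, 'n::finite, 'm::finite) gfe \<Rightarrow> ((real ^ 'd \<Rightarrow> real ^ 'N) \<Rightarrow> real) \<Rightarrow>
     (real ^ 'N) ^ 'n \<Rightarrow> real" where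
  "alg_energy S \<J> v = \<J> (eval_inv S v)"

definition d_alg ::
    "('d::finite, 'N::finite, 'n::finite, 'm::finite) gfe \<Rightarrow> ((real ^ 'd \<Rightarrow> real ^ 'N) \<Rightarrow> real) \<Rightarrow>
     (real ^ 'N) ^ 'n \<Rightarrow> (real ^ 'N) ^ 'n \<Rightarrow> real" where
  "d_alg S \<J> v = frechet_derivative (alg_energy S \<J>) (at v within alg_space S)"

text \<open>The differentiable structure of \<open>Vh S\<close> is the one inherited from \<open>alg_space S\<close> through
  \<open>eval_nodes S\<close>.\<close>

definition Vh_differentiable ::
    "('d::finite, 'N::finite, 'n::finite, 'm::finite) gfe \<Rightarrow> ((real ^ 'd \<Rightarrow> real ^ 'N) \<Rightarrow> real) \<Rightarrow>
     (real ^ 'd \<Rightarrow> real ^ 'N) \<Rightarrow> bool" where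
  "Vh_differentiable S \<J> u \<longleftrightarrow>
     (\<lambda>w. \<J> (eval_inv S w)) differentiable (at (eval_nodes S u) within alg_space S)"

definition Vh_curve ::
    "('d::finite, 'N::finite, 'n::finite, 'm::finite) gfe \<Rightarrow> (real \<Rightarrow> real ^ 'd \<Rightarrow> real ^ 'N) \<Rightarrow> bool"
where
  "Vh_curve S c \<longleftrightarrow>
     (\<exists>\<epsilon> C. diff_curve \<epsilon> (alg_space S) C \<and> (\<forall>t\<in>{-\<epsilon><..<\<epsilon>}. c t = eval_inv S (C t)))"

text \<open>\<open>c\<close> is a differentiable curve in \<open>Vh S\<close> through \<open>u\<close> with pointwise derivative \<open>\<eta>\<close>; the
  \<open>\<eta>\<close> that occur for some \<open>c\<close> are the test functions along \<open>u\<close>.\<close>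

definition variation ::
    "('d::finite, 'N::finite, 'n::finite, 'm::finite) gfe \<Rightarrow> (real ^ 'd \<Rightarrow> real ^ 'N) \<Rightarrow>
     (real ^ 'd \<Rightarrow> real ^ 'N) \<Rightarrow> (real \<Rightarrow> real ^ 'd \<Rightarrow> real ^ 'N) \<Rightarrow> bool" where
  "variation S u \<eta> c \<longleftrightarrow> Vh_curve S c \<and> c 0 = u \<and>
     (\<forall>x\<in>closure (dom\<Omega> S). ((\<lambda>t. c t x) has_vector_derivative \<eta> x) (at 0))"

definition d_energy ::
    "('d::finite, 'N::finite, 'n::finite, 'm::finite) gfe \<Rightarrow> ((real ^ 'd \<Rightarrow> real ^ 'N) \<Rightarrow> real) \<Rightarrow>
     (real ^ 'd \<Rightarrow> real ^ 'N) \<Rightarrow> (real ^ 'd \<Rightarrow> real ^ 'N) \<Rightarrow> real" where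
  "d_energy S \<J> u \<eta> =
     (THE D. \<exists>c. variation S u \<eta> c \<and> ((\<lambda>t. \<J> (c t)) has_real_derivative D) (at 0))"

end

theory Submission
  imports Defs
begin

text \<open>A tangent vector \<open>\<eta>\<close> at \<open>v\<close> is the velocity of a curve \<open>C\<close> of coefficients, and \<open>C\<close> yields the
  curve \<open>c t = eval_inv S (C t)\<close> of finite element functions. Along these two curves the algebraic
  energy and the energy functional are the same function of \<open>t\<close>. Hence both differentials agree,
  \<open>d_energy S \<J> (eval_inv S v) (test_fun_op S v \<eta>) = d_alg S \<J> v \<eta>\<close> for every tangent vector \<open>\<eta>\<close>
  (\<open>d_energy_test_fun_op\<close>), and one vanishes for all \<open>\<eta>\<close> if and only if the other does. Two points
  need an argument.

  The pointwise derivative of \<open>c\<close> at \<open>0\<close> is the test function assigned to \<open>\<eta>\<close>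
  (\<open>test_fun_op_variation\<close>). On each element, \<open>c t\<close> is the interpolant of the local entries of
  \<open>C t\<close>, because an interpolant takes its prescribed values at the Lagrange nodes
  (\<open>interpolates_at_node\<close>, \<open>eval_inv_eq_interp\<close>). The chain rule, applied to a local \<open>C^1\<close> extension
  of the interpolation operator, then gives the sum over the partial derivatives
  (\<open>total_differential_eq_sum_partials\<close>).

  The derivative of the energy in the direction of a test function is independent of the curve
  that represents it (\<open>energy_derivative_along_variation\<close>): any such curve comes from a curve of
  coefficients, whose velocity is read off by evaluating the test function at the nodes.\<close>

section \<open>Differentiating along curves in a set\<close>

lemma has_vector_derivative_along_curve:
  assumes f: "(f has_derivative D) (at q within A)"
    and C: "diff_curve \<epsilon> A C" "C 0 = q" "(C has_vector_derivative b) (at 0)"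
  shows "((\<lambda>t. f (C t)) has_vector_derivative D b) (at 0)"
proof -
  let ?I = "{-\<epsilon><..<\<epsilon>}"
  have I: "open ?I" "0 \<in> ?I" "C ` ?I \<subseteq> A"
    using C(1) by (auto simp: diff_curve_def)
  have "(f has_derivative D) (at (C 0) within C ` ?I)"
    using has_derivative_subset[OF f I(3)] C(2) by simp
  moreover have "(C has_vector_derivative b) (at 0 within ?I)"
    using C(3) by (rule has_vector_derivative_at_within)
  ultimately have "((\<lambda>t. f (C t)) has_vector_derivative D b) (at 0 within ?I)"
    using vector_derivative_diff_chain_within by (force simp: o_def)
  then show ?thesis
    using at_within_open[OF I(2,1)] by simp
qed

text \<open>A derivative within a set is in general not unique, but along a curve in the set it is forced
  by the chain rule.\<close>

lemma has_derivative_unique_on_tangent_space: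
  assumes "(f has_derivative D) (at q within A)" "(f has_derivative D') (at q within A)"
    and b: "b \<in> tangent_space A q"
  shows "D b = D' b"
proof -
  obtain \<epsilon> \<gamma> where "diff_curve \<epsilon> A \<gamma>" "\<gamma> 0 = q" "(\<gamma> has_vector_derivative b) (at 0)"
    using b by (auto simp: tangent_space_def)
  with assms(1,2) show ?thesis
    by (meson has_vector_derivative_along_curve vector_derivative_unique_at)
qed

lemma sum_axis_components: "(\<Sum>i\<in>UNIV. axis i (x $ i)) = x"
  for x :: "'a::real_normed_vector ^ 'k::finite"
  by (simp add: vec_eq_iff axis_def if_distrib sum.If_cases cong del: if_weak_cong)

lemma norm_axis: "norm (axis i x :: 'a::real_normed_vector ^ 'k::finite) = norm x"
proof -
  have "(\<Sum>j\<in>UNIV. (norm ((axis i x :: 'a ^ 'k) $ j))\<^sup>2) = (\<Sum>j\<in>UNIV. if j = i then (norm x)\<^sup>2 else 0)"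
    by (intro sum.cong) (auto simp: axis_def)
  then show ?thesis
    by (simp add: norm_vec_def L2_set_def)
qed

lemma bounded_linear_axis: "bounded_linear (axis i :: 'a::real_normed_vector \<Rightarrow> 'a ^ 'k::finite)"
proof (rule bounded_linear_intro[where K = 1])
  show "axis i (x + y) = (axis i x + axis i y :: 'a ^ 'k)" for x y
    by (simp add: vec_eq_iff axis_def)
  show "axis i (r *\<^sub>R x) = (r *\<^sub>R axis i x :: 'a ^ 'k)" for r x
    by (simp add: vec_eq_iff axis_def)
  show "norm (axis i x :: 'a ^ 'k) \<le> norm x * 1" for x
    by (simp add: norm_axis)
qed

lemma has_vector_derivative_vec_lambda:
  fixes \<gamma> :: "'k::finite \<Rightarrow> real \<Rightarrow> 'a::real_normed_vector"
  assumes "\<And>i. (\<gamma> i has_vector_derivative b $ i) F"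
  shows "((\<lambda>t. \<chi> i. \<gamma> i t) has_vector_derivative b) F"
proof -
  have "((\<lambda>t. \<Sum>i\<in>UNIV. axis i (\<gamma> i t)) has_vector_derivative (\<Sum>i\<in>UNIV. axis i (b $ i))) F"
    by (intro has_vector_derivative_sum
        bounded_linear.has_vector_derivative[OF bounded_linear_axis] assms)
  then show ?thesis
    using sum_axis_components[of "\<chi> i. \<gamma> i _"] by (simp add: sum_axis_components)
qed

lemma diff_curve_shrink:
  assumes C: "diff_curve \<epsilon> A C" and U: "open U" "C 0 \<in> U"
  obtains \<delta> where "diff_curve \<delta> (A \<inter> U) C"
proof -
  have "isCont C 0"
    using C by (auto simp: diff_curve_def intro: differentiable_imp_continuous_within)
  then have "\<forall>\<^sub>F t in at 0. C t \<in> U"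
    using U by (auto simp: isCont_def intro: topological_tendstoD)
  then obtain d where d: "0 < d" "\<And>t. t \<noteq> 0 \<Longrightarrow> dist t 0 < d \<Longrightarrow> C t \<in> U"
    by (auto simp: eventually_at)
  have "C t \<in> U" if "\<bar>t\<bar> < d" for t
    using d(2)[of t] U(2) that by (cases "t = 0") (auto simp: dist_real_def)
  then have "diff_curve (min \<epsilon> d) (A \<inter> U) C"
    using C d(1) by (auto simp: diff_curve_def)
  then show thesis
    by (rule that)
qed

text \<open>Componentwise curves combine to a curve in the power of \<open>M\<close>; by continuity it stays in a
  relatively open part after shortening the parameter interval.\<close>

lemma tangent_Mpow_curve:
  fixes v b :: "'a::real_normed_vector ^ 'k::finite"
  assumes b: "b \<in> tangent_Mpow M v" and A: "openin (top_of_set (Mpow M)) A" "v \<in> A"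
  obtains \<epsilon> C where "diff_curve \<epsilon> A C" "C 0 = v" "(C has_vector_derivative b) (at 0)"
proof -
  have "\<exists>\<epsilon> \<gamma>. diff_curve \<epsilon> M \<gamma> \<and> \<gamma> 0 = v $ i \<and> (\<gamma> has_vector_derivative b $ i) (at 0)" for i
    using b by (auto simp: tangent_Mpow_def tangent_space_def)
  then obtain \<epsilon> \<gamma> where \<gamma>: "\<And>i. diff_curve (\<epsilon> i) M (\<gamma> i)" "\<And>i. \<gamma> i 0 = v $ i"
      "\<And>i. (\<gamma> i has_vector_derivative b $ i) (at 0)"
    by metis
  define C where "C = (\<lambda>t. \<chi> i. \<gamma> i t)"
  define \<epsilon>0 where "\<epsilon>0 = Min (range \<epsilon>)"
  have \<epsilon>0: "0 < \<epsilon>0" "\<epsilon>0 \<le> \<epsilon> i" for i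
    using \<gamma>(1) by (auto simp: \<epsilon>0_def diff_curve_def)
  have der: "(C has_vector_derivative b) (at 0)"
    unfolding C_def by (intro has_vector_derivative_vec_lambda \<gamma>(3))
  have C0: "C 0 = v"
    by (simp add: C_def \<gamma>(2) vec_eq_iff)
  have inM: "C t \<in> Mpow M" and diff: "C differentiable (at t)" if t: "t \<in> {-\<epsilon>0<..<\<epsilon>0}" for t
  proof -
    have ti: "t \<in> {-\<epsilon> i<..<\<epsilon> i}" for i
      using t \<epsilon>0(2)[of i] by auto
    then show "C t \<in> Mpow M"
      using \<gamma>(1) by (auto simp: C_def Mpow_def diff_curve_def)
    have "(\<gamma> i has_vector_derivative (\<chi> i. vector_derivative (\<gamma> i) (at t)) $ i) (at t)" for i
      using \<gamma>(1)[of i] ti[of i] by (auto simp: diff_curve_def vector_derivative_works)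
    then show "C differentiable (at t)"
      unfolding C_def by (blast intro: differentiableI_vector has_vector_derivative_vec_lambda)
  qed
  have "diff_curve \<epsilon>0 (Mpow M) C"
    using \<epsilon>0(1) inM diff by (simp add: diff_curve_def)
  moreover obtain U where U: "open U" "A = Mpow M \<inter> U"
    using A(1) by (auto simp: openin_open)
  moreover have "C 0 \<in> U"
    using A(2) U(2) C0 by simp
  ultimately obtain \<delta> where "diff_curve \<delta> A C"
    using diff_curve_shrink by metis
  then show thesis
    using C0 der that by blast
qed

lemma has_derivative_insert_component:
  "((\<lambda>q. \<chi> j. if j = k then q else w $ j) has_derivative axis k) F"
  for w :: "'a::real_normed_vector ^ 'k::finite"
proof -
  have "(\<lambda>q. \<chi> j. if j = k then q else w $ j) = (\<lambda>q. axis k q + (\<chi> j. if j = k then 0 else w $ j))"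
    by (auto simp: vec_eq_iff axis_def)
  then show ?thesis
    by (auto intro!: derivative_eq_intros bounded_linear_imp_has_derivative bounded_linear_axis)
qed

text \<open>On tangent vectors the differential of a \<open>C^1\<close> map on (part of) a power of \<open>M\<close> is the sum of
  its partial differentials: a \<open>C^1\<close> extension to an open set has a linear derivative there, and each
  partial differential is determined by that extension. Components on which the map does not depend
  contribute zero.\<close>

lemma total_differential_eq_sum_partials:
  fixes f :: "'a::euclidean_space ^ 'k::finite \<Rightarrow> 'b::real_normed_vector"
  assumes C1: "C1_on_submanifold (W \<inter> Mpow M) f"
    and W: "open W" "w \<in> W" "w \<in> Mpow M"
    and indep: "\<And>u u'. (\<And>k. k \<in> I \<Longrightarrow> u $ k = u' $ k) \<Longrightarrow> f u = f u'"
    and b: "b \<in> tangent_Mpow M w"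
  obtains L where "(f has_derivative L) (at w within W \<inter> Mpow M)"
    "L b = (\<Sum>k\<in>I. frechet_derivative (\<lambda>q. f (\<chi> j. if j = k then q else w $ j))
                    (at (w $ k) within M) (b $ k))"
proof -
  define h where "h = (\<lambda>k q. \<chi> j. if j = k then q else w $ j)"
  have hw: "h k (w $ k) = w" for k
    by (simp add: h_def vec_eq_iff)
  obtain U g where U: "open U" "w \<in> U" "Ck_on 1 U g" "\<And>u. u \<in> U \<inter> (W \<inter> Mpow M) \<Longrightarrow> g u = f u"
    using C1 W(2,3) unfolding C1_on_submanifold_def by (metis IntI)
  have "g differentiable (at w)"
    using U by simp
  then obtain L where L: "(g has_derivative L) (at w)"
    by (auto simp: differentiable_def)
  have "open (U \<inter> W)" "w \<in> U \<inter> W"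
    using U W by auto
  then obtain d where d: "d > 0" "\<And>u. dist u w < d \<Longrightarrow> u \<in> U \<inter> W"
    by (metis open_dist)
  have fL: "(f has_derivative L) (at w within W \<inter> Mpow M)"
    by (rule has_derivative_transform_within[OF has_derivative_at_withinI[OF L] d(1)])
      (use W d U in auto)
  have part: "((\<lambda>q. f (h k q)) has_derivative (\<lambda>x. L (axis k x))) (at (w $ k) within M)" for k
  proof (rule has_derivative_transform_within[OF _ d(1)])
    have "(g has_derivative L) (at (h k (w $ k)))"
      using L by (simp add: hw)
    then show "((\<lambda>q. g (h k q)) has_derivative (\<lambda>x. L (axis k x))) (at (w $ k) within M)"
      by (intro has_derivative_compose[of "h k" _ _ _ g])
        (simp_all add: has_derivative_insert_component h_def)
    show "w $ k \<in> M"
      using W by (auto simp: Mpow_def)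
  next
    fix q assume q: "q \<in> M" "dist q (w $ k) < d"
    have "h k q - w = axis k (q - w $ k)"
      by (simp add: h_def vec_eq_iff axis_def)
    then have "dist (h k q) w < d"
      using q by (simp add: dist_norm norm_axis)
    moreover have "h k q \<in> Mpow M"
      using q W by (auto simp: h_def Mpow_def)
    ultimately show "g (h k q) = f (h k q)"
      using d U by blast
  qed
  have bk: "b $ k \<in> tangent_space M (w $ k)" for k
    using b by (auto simp: tangent_Mpow_def)
  have partial: "L (axis k (b $ k)) = frechet_derivative (\<lambda>q. f (h k q)) (at (w $ k) within M) (b $ k)"
    for k
    using has_derivative_unique_on_tangent_space[OF part _ bk] part frechet_derivative_works
    unfolding differentiable_def by blast
  have zero: "L (axis k (b $ k)) = 0" if "k \<notin> I" for k
  proof -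
    have "f (h k q) = f w" for q
      using that by (intro indep) (auto simp: h_def)
    then have "((\<lambda>q. f (h k q)) has_derivative (\<lambda>_. 0)) (at (w $ k) within M)"
      by simp
    then show ?thesis
      using has_derivative_unique_on_tangent_space[OF part _ bk] by blast
  qed
  interpret L: bounded_linear L
    using L by (rule has_derivative_bounded_linear)
  have "L b = (\<Sum>k\<in>UNIV. L (axis k (b $ k)))"
    by (simp add: sum_axis_components flip: L.sum)
  also have "\<dots> = (\<Sum>k\<in>I. L (axis k (b $ k)))"
    by (rule sum.mono_neutral_right) (auto simp: zero)
  also have "\<dots> = (\<Sum>k\<in>I. frechet_derivative (\<lambda>q. f (h k q)) (at (w $ k) within M) (b $ k))"
    by (simp add: partial)
  finally show thesis
    using fL that by (simp add: h_def)
qed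

section \<open>Riemannian distance and interpolation at the nodes\<close>

lemma riem_dist_refl:
  assumes "p \<in> M"
  shows "riem_dist M p p = 0"
proof -
  let ?X = "{curve_length \<gamma> |\<gamma>. \<gamma> piecewise_C1_differentiable_on {0..1} \<and>
     (\<lambda>t. norm (vector_derivative \<gamma> (at t))) integrable_on {0..1} \<and>
     \<gamma> ` {0..1} \<subseteq> M \<and> \<gamma> 0 = p \<and> \<gamma> 1 = p}"
  have "0 \<in> ?X"
    by (rule CollectI, rule exI[where x = "\<lambda>_. p"])
      (use assms in \<open>auto simp: curve_length_def intro: piecewise_C1_differentiable_const\<close>)
  moreover have "0 \<le> x" if "x \<in> ?X" for x
    using that by (auto simp: curve_length_def intro!: integral_nonneg)
  ultimately show ?thesis
    unfolding riem_dist_def by (rule cInf_eq_minimum)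
qed

text \<open>Where \<open>\<gamma>\<close> is not differentiable, its reversal is not differentiable at the reflected point
  either, and both derivatives have the same default value.\<close>

lemma norm_vector_derivative_reverse:
  fixes \<gamma> :: "real \<Rightarrow> 'a::real_normed_vector"
  shows "norm (vector_derivative (\<lambda>t. \<gamma> (1 - t)) (at t)) = norm (vector_derivative \<gamma> (at (1 - t)))"
proof -
  have rev: "((\<lambda>t. g (1 - t)) has_vector_derivative - D) (at (1 - s))"
    if "(g has_vector_derivative D) (at s)" for g :: "real \<Rightarrow> 'a" and D s
  proof -
    have "((\<lambda>t. 1 - t) has_vector_derivative - 1) (at (1 - s))"
      by (auto intro!: derivative_eq_intros)
    then show ?thesis
      using vector_diff_chain_at[of "\<lambda>t. 1 - t" "-1" "1 - s" g D] that by (simp add: o_def)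
  qed
  show ?thesis
  proof (cases "\<exists>D. (\<gamma> has_vector_derivative D) (at (1 - t))")
    case True
    then obtain D where D: "(\<gamma> has_vector_derivative D) (at (1 - t))"
      by blast
    then show ?thesis
      using rev[OF D] by (simp add: vector_derivative_at)
  next
    case False
    have "\<not> ((\<lambda>t. \<gamma> (1 - t)) has_vector_derivative D) (at t)" for D
      using rev[of "\<lambda>t. \<gamma> (1 - t)" D t] False by auto
    with False show ?thesis
      by (simp add: vector_derivative_def)
  qed
qed

lemma riem_dist_commute:
  fixes M :: "'a::euclidean_space set"
  shows "riem_dist M p q = riem_dist M q p"
proof -
  let ?P = "\<lambda>\<gamma> p q. \<gamma> piecewise_C1_differentiable_on {0..1} \<and>
     (\<lambda>t. norm (vector_derivative \<gamma> (at t))) integrable_on {0..1} \<and>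
     \<gamma> ` {0..1} \<subseteq> M \<and> \<gamma> 0 = p \<and> \<gamma> 1 = q"
  have reverse: "?P (\<lambda>t. \<gamma> (1 - t)) q p \<and> curve_length (\<lambda>t. \<gamma> (1 - t)) = curve_length \<gamma>"
    if \<gamma>: "?P \<gamma> p q" for \<gamma> :: "real \<Rightarrow> 'a" and p q
  proof -
    have "((\<lambda>t. norm (vector_derivative \<gamma> (at t))) has_integral curve_length \<gamma>) (cbox 0 1)"
      using \<gamma> by (simp add: curve_length_def has_integral_integral)
    from has_integral_affinity[OF this, of "-1" 1]
    have "((\<lambda>t. norm (vector_derivative (\<lambda>t. \<gamma> (1 - t)) (at t))) has_integral curve_length \<gamma>) {0..1}"
      by (simp add: norm_vector_derivative_reverse)
    then have "(\<lambda>t. norm (vector_derivative (\<lambda>t. \<gamma> (1 - t)) (at t))) integrable_on {0..1}"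
        "curve_length (\<lambda>t. \<gamma> (1 - t)) = curve_length \<gamma>"
      by (auto simp: curve_length_def integral_unique)
    moreover have "(\<lambda>t. \<gamma> (1 - t)) piecewise_C1_differentiable_on {0..1}"
      using valid_path_imp_reverse[of \<gamma>] \<gamma> by (simp add: valid_path_def reversepath_def)
    ultimately show ?thesis
      using \<gamma> by auto
  qed
  have "{curve_length \<gamma> |\<gamma>. ?P \<gamma> p q} \<subseteq> {curve_length \<gamma> |\<gamma>. ?P \<gamma> q p}" for p q
  proof
    fix l assume "l \<in> {curve_length \<gamma> |\<gamma>. ?P \<gamma> p q}"
    then obtain \<gamma> where "l = curve_length \<gamma>" "?P \<gamma> p q"
      by blast
    then show "l \<in> {curve_length \<gamma> |\<gamma>. ?P \<gamma> q p}"
      using reverse[of \<gamma> p q] by (intro CollectI exI[where x = "\<lambda>t. \<gamma> (1 - t)"]) metis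
  qed
  \<comment> \<open>The sets themselves coincide, so the infima do even when there is no connecting curve.\<close>
  then have "{curve_length \<gamma> |\<gamma>. ?P \<gamma> p q} = {curve_length \<gamma> |\<gamma>. ?P \<gamma> q p}"
    by blast
  then show ?thesis
    by (simp add: riem_dist_def)
qed

lemma interpolates_cong:
  assumes "\<And>k. k \<in> ref_idx R \<Longrightarrow> w $ k = w' $ k"
  shows "interpolates M r R w \<xi> q = interpolates M r R w' \<xi> q"
  using assms by (cases r) (simp_all cong: sum.cong)

lemma interp_cong:
  assumes "\<And>k. k \<in> ref_idx (ref S T) \<Longrightarrow> w $ k = w' $ k"
  shows "interp S T w \<xi> = interp S T w' \<xi>"
  unfolding interp_def
  by (rule arg_cong[where f = The], rule ext, rule interpolates_cong, rule assms)

text \<open>For the projection rule, the Kronecker property of the shape functions gives the value at a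
  node at once. For the geodesic rule, the functional at a node is the squared distance to the
  nodal value, so a minimizer \<open>q\<close> has distance zero to \<open>w $ k\<close>. That it equals \<open>w $ k\<close> is taken
  from uniqueness of minimizers. In the application the tuple \<open>w\<close> is arbitrary, while uniqueness
  is known only near given coefficients; therefore it is required of a second tuple \<open>w'\<close> with
  value \<open>q\<close> at the node, and symmetry of the distance makes \<open>w $ k\<close> a minimizer for \<open>w'\<close>.\<close>

lemma interpolates_at_node:
  assumes R: "lagrange_element p R" and r: "admissible_rule M r"
    and w: "w \<in> Mpow M" and k: "k \<in> ref_idx R"
    and q: "interpolates M r R w (ref_node R k) q"
    and w': "w' \<in> Mpow M" "w' $ k = q" "\<exists>!q. interpolates M r R w' (ref_node R k) q"
  shows "w $ k = q"
proof (cases r)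
  case Geodesic
  have fin: "finite (ref_idx R)"
    by simp
  have dist_k: "(\<Sum>i\<in>ref_idx R. ref_shape R i (ref_node R k) * (riem_dist M (u $ i) z)\<^sup>2)
      = (riem_dist M (u $ k) z)\<^sup>2" for u z
  proof -
    have "(\<Sum>i\<in>ref_idx R. ref_shape R i (ref_node R k) * (riem_dist M (u $ i) z)\<^sup>2)
        = (\<Sum>i\<in>ref_idx R. if i = k then (riem_dist M (u $ i) z)\<^sup>2 else 0)"
      using R k by (intro sum.cong) (auto simp: lagrange_element_def)
    then show ?thesis
      using k by (simp add: sum.delta'[OF fin] sum.delta[OF fin])
  qed
  have min_iff: "interpolates M r R u (ref_node R k) z \<longleftrightarrow>
      z \<in> M \<and> (\<forall>y\<in>M. (riem_dist M (u $ k) z)\<^sup>2 \<le> (riem_dist M (u $ k) y)\<^sup>2)" for u z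
    by (auto simp: Geodesic is_arg_min_linorder dist_k)
  have wk: "w $ k \<in> M" and qM: "q \<in> M"
    using w w' by (auto simp: Mpow_def)
  have "(riem_dist M (w $ k) q)\<^sup>2 \<le> (riem_dist M (w $ k) (w $ k))\<^sup>2"
    using q wk by (simp add: min_iff)
  then have "riem_dist M q (w $ k) = 0"
    by (simp add: riem_dist_refl[OF wk] riem_dist_commute[of M q])
  then have "interpolates M r R w' (ref_node R k) (w $ k)"
    using wk by (simp add: min_iff w'(2))
  moreover have "interpolates M r R w' (ref_node R k) q"
    using qM by (simp add: min_iff w'(2) riem_dist_refl)
  ultimately show ?thesis
    using w'(3) by blast
next
  case (Projection U P)
  have "(\<Sum>i\<in>ref_idx R. ref_shape R i (ref_node R k) *\<^sub>R (w $ i))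
      = (\<Sum>i\<in>ref_idx R. if i = k then w $ i else 0)"
    using R k by (intro sum.cong) (auto simp: lagrange_element_def)
  also have "\<dots> = w $ k"
    using k by simp
  finally show ?thesis
    using q r w by (auto simp: Projection Mpow_def Let_def)
qed

section \<open>Finite element functions as interpolants of their nodal values\<close>

lemma element_homeomorphism:
  assumes "gfe_setting S" "T \<in> grid S"
  obtains G where "homeomorphism T (closure (ref_dom (ref S T))) (ref_map S T) G"
proof -
  have "element_map T (ref_dom (ref S T)) (ref_map S T)"
    using assms by (simp add: gfe_setting_def conforming_grid_def)
  then show thesis
    using that unfolding element_map_def by blast
qed

lemma ref_map_in_closure:
  assumes "gfe_setting S" "T \<in> grid S" "x \<in> T"
  shows "ref_map S T x \<in> closure (ref_dom (ref S T))"
proof -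
  obtain G where "homeomorphism T (closure (ref_dom (ref S T))) (ref_map S T) G"
    using assms(1,2) by (rule element_homeomorphism)
  then show ?thesis
    using assms(3) by (auto simp: homeomorphism_def)
qed

lemma element_lagrange:
  assumes "gfe_setting S" "T \<in> grid S"
  shows "lagrange_element (order S) (ref S T)"
  using assms by (simp add: gfe_setting_def conforming_grid_def)

lemma grid_cover:
  assumes "gfe_setting S"
  shows "\<Union>(grid S) = closure (dom\<Omega> S)"
  using assms by (simp add: gfe_setting_def conforming_grid_def)

lemma node_in_closure:
  assumes "gfe_setting S"
  shows "node S i \<in> closure (dom\<Omega> S)"
proof -
  have "node S i \<in> range (node S)"
    by simp
  then have "node S i \<in> \<Union>(grid S)"
    using assms by (auto simp: gfe_setting_def)
  then show ?thesis
    by (simp add: grid_cover[OF assms])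
qed

lemma node_global_idx:
  assumes S: "gfe_setting S" and T: "T \<in> grid S" and k: "k \<in> ref_idx (ref S T)"
  shows "node S (global_idx S T k) \<in> T"
    and "ref_map S T (node S (global_idx S T k)) = ref_node (ref S T) k"
proof -
  obtain G where G: "homeomorphism T (closure (ref_dom (ref S T))) (ref_map S T) G"
    using S T by (rule element_homeomorphism)
  have "ref_node (ref S T) k \<in> closure (ref_dom (ref S T))"
    using element_lagrange[OF S T] k by (auto simp: lagrange_element_def)
  then obtain x where x: "x \<in> T" "ref_map S T x = ref_node (ref S T) k"
    using G by (metis homeomorphism_def imageE)
  then have "x \<in> range (node S)"
    using S T k by (auto simp: gfe_setting_def)
  then obtain i where i: "x = node S i"
    by auto
  have "j = i" if "node S j \<in> T" "ref_map S T (node S j) = ref_node (ref S T) k" for j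
  proof -
    have "node S j = node S i"
      using that x i G by (metis homeomorphism_def)
    then show ?thesis
      using S by (auto simp: gfe_setting_def dest: injD)
  qed
  then have "\<exists>!i. node S i \<in> T \<and> ref_map S T (node S i) = ref_node (ref S T) k"
    using x i by blast
  then have "node S (global_idx S T k) \<in> T \<and>
      ref_map S T (node S (global_idx S T k)) = ref_node (ref S T) k"
    unfolding global_idx_def by (rule theI')
  then show "node S (global_idx S T k) \<in> T"
    "ref_map S T (node S (global_idx S T k)) = ref_node (ref S T) k"
    by auto
qed

lemma alg_space_subset_tilde: "alg_space S \<subseteq> alg_space_tilde S"
  by (simp add: alg_space_def interior_of_subset)

lemma alg_space_subset: "alg_space S \<subseteq> Mpow (mfd S)"
  using alg_space_subset_tilde[of S] unfolding alg_space_tilde_def by blast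

lemma openin_alg_space: "openin (top_of_set (Mpow (mfd S))) (alg_space S)"
  by (simp add: alg_space_def)

lemma eval_inv_in_Vh:
  assumes "v \<in> alg_space S"
  shows "eval_inv S v \<in> Vh S" and "eval_nodes S (eval_inv S v) = v"
proof -
  have "v \<in> alg_space_tilde S"
    using assms alg_space_subset_tilde by (rule subsetD[rotated])
  then have "\<exists>!u. u \<in> Vh S \<and> eval_nodes S u = v"
    by (simp add: alg_space_tilde_def)
  then have "eval_inv S v \<in> Vh S \<and> eval_nodes S (eval_inv S v) = v"
    unfolding eval_inv_def by (rule theI')
  then show "eval_inv S v \<in> Vh S" "eval_nodes S (eval_inv S v) = v"
    by auto
qed

lemma bounded_linear_local_values: "bounded_linear (local_values S T)"
proof -
  have "linear (local_values S T)"
    by (rule linearI) (simp_all add: local_values_def vec_eq_iff)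
  then show ?thesis
    by (rule linear_conv_bounded_linear[THEN iffD1])
qed

lemma local_values_in_Mpow: "v \<in> Mpow M \<Longrightarrow> local_values S T v \<in> Mpow M"
  by (simp add: local_values_def Mpow_def)

text \<open>A finite element function is on each element the interpolant of some tuple of local values.
  That this tuple consists of the nodal values is the interpolation property at the nodes.\<close>

lemma eval_inv_eq_interp:
  assumes S: "gfe_setting S" and v: "v \<in> alg_space S" and T: "T \<in> grid S" and x: "x \<in> T"
    and unique: "\<And>\<xi>. \<xi> \<in> closure (ref_dom (ref S T)) \<Longrightarrow>
      \<exists>!q. interpolates (mfd S) (rule S) (ref S T) (local_values S T v) \<xi> q"
  shows "eval_inv S v x = interp S T (local_values S T v) (ref_map S T x)"
proof -
  let ?u = "eval_inv S v" and ?w = "local_values S T v" and ?R = "ref S T"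
  obtain w where w: "w \<in> Mpow (mfd S)"
      "\<And>x. x \<in> T \<Longrightarrow> interpolates (mfd S) (rule S) ?R w (ref_map S T x) (?u x)"
    using eval_inv_in_Vh(1)[OF v] T by (auto simp: Vh_def)
  have "w $ k = ?w $ k" if k: "k \<in> ref_idx ?R" for k
  proof -
    note i = node_global_idx[OF S T k]
    have uk: "?u (node S (global_idx S T k)) = ?w $ k"
      using eval_inv_in_Vh(2)[OF v] by (simp add: local_values_def eval_nodes_def vec_eq_iff)
    show ?thesis
    proof (rule interpolates_at_node[OF element_lagrange[OF S T] _ w(1) k])
      show "admissible_rule (mfd S) (rule S)"
        using S by (simp add: gfe_setting_def)
      show "interpolates (mfd S) (rule S) ?R w (ref_node ?R k) (?w $ k)"
        using w(2)[OF i(1)] by (simp add: i(2) uk)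
      show "?w \<in> Mpow (mfd S)"
        using v alg_space_subset by (blast intro: local_values_in_Mpow)
      show "\<exists>!q. interpolates (mfd S) (rule S) ?R ?w (ref_node ?R k) q"
        using unique[OF ref_map_in_closure[OF S T i(1)]] by (simp add: i(2))
    qed simp
  qed
  then have "interpolates (mfd S) (rule S) ?R ?w (ref_map S T x) (?u x)"
    using w(2)[OF x] interpolates_cong by blast
  then show ?thesis
    unfolding interp_def
    by (rule the1_equality[OF unique[OF ref_map_in_closure[OF S T x]], symmetric])
qed

section \<open>Test functions as derivatives of curves\<close>

text \<open>Near \<open>0\<close> the local entries of \<open>C t\<close> stay in the set where the interpolation is single-valued and
  \<open>C^1\<close>, so the function value at \<open>x\<close> is the interpolation operator composed with a curve.\<close>

lemma has_vector_derivative_eval_inv: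
  assumes S: "gfe_setting S" and reg: "regular_interpolation S v"
    and C: "diff_curve \<epsilon> (alg_space S) C" "C 0 = v" "(C has_vector_derivative b) (at 0)"
    and b: "b \<in> tangent_Mpow (mfd S) v" and T: "T \<in> grid S" and x: "x \<in> T"
  shows "((\<lambda>t. eval_inv S (C t) x) has_vector_derivative
           (\<Sum>k\<in>ref_idx (ref S T).
              partial_interp S T k (local_values S T v) (ref_map S T x) (local_values S T b $ k))) (at 0)"
proof -
  let ?M = "mfd S" and ?\<xi> = "ref_map S T x" and ?l = "local_values S T"
  from bspec[OF reg[unfolded regular_interpolation_def] T]
  obtain W where W: "open W" "?l v \<in> W"
      and W': "\<forall>\<xi>\<in>closure (ref_dom (ref S T)).
        (\<forall>w \<in> W \<inter> Mpow ?M. \<exists>!q. interpolates ?M (rule S) (ref S T) w \<xi> q) \<and>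
        C1_on_submanifold (W \<inter> Mpow ?M) (\<lambda>w. interp S T w \<xi>)"
    by (elim exE conjE) (rule that)
  note unique = W'[THEN bspec, THEN conjunct1, THEN bspec]
    and C1 = W'[THEN bspec, THEN conjunct2]
  have "C 0 \<in> alg_space S"
    using C(1) by (simp add: diff_curve_def)
  then have vM: "v \<in> Mpow ?M"
    using C(2) alg_space_subset by blast
  have lb: "?l b \<in> tangent_Mpow ?M (?l v)"
    using b by (simp add: tangent_Mpow_def local_values_def)
  obtain L where L: "((\<lambda>w. interp S T w ?\<xi>) has_derivative L) (at (?l v) within W \<inter> Mpow ?M)"
      "L (?l b) = (\<Sum>k\<in>ref_idx (ref S T). partial_interp S T k (?l v) ?\<xi> (?l b $ k))"
  proof (rule total_differential_eq_sum_partials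
      [OF C1[OF ref_map_in_closure[OF S T x]] W local_values_in_Mpow[OF vM] _ lb])
    show "interp S T w ?\<xi> = interp S T w' ?\<xi>"
      if "\<And>k. k \<in> ref_idx (ref S T) \<Longrightarrow> w $ k = w' $ k" for w w'
      using that by (rule interp_cong)
  qed (rule that, assumption, simp only: partial_interp_def)
  have der: "((\<lambda>t. ?l (C t)) has_vector_derivative ?l b) (at 0)"
    using bounded_linear.has_vector_derivative[OF bounded_linear_local_values C(3)] .
  have "open (?l -` W)"
    by (rule open_vimage[OF W(1) linear_continuous_on[OF bounded_linear_local_values]])
  then obtain \<epsilon>' where C': "diff_curve \<epsilon>' (alg_space S \<inter> ?l -` W) C"
    using diff_curve_shrink[OF C(1)] W(2) C(2) by (metis vimageI)
  then have \<epsilon>': "0 < \<epsilon>'"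
    by (simp add: diff_curve_def)
  have near: "C t \<in> alg_space S \<and> ?l (C t) \<in> W \<inter> Mpow ?M \<and> C differentiable (at t)"
    if "t \<in> {-\<epsilon>'<..<\<epsilon>'}" for t
  proof -
    have t: "C t \<in> alg_space S" "?l (C t) \<in> W" "C differentiable (at t)"
      using that C' by (auto simp: diff_curve_def)
    moreover have "C t \<in> Mpow ?M"
      using t(1) alg_space_subset by (rule subsetD[rotated])
    ultimately show ?thesis
      by (simp add: local_values_in_Mpow)
  qed
  have "diff_curve \<epsilon>' (W \<inter> Mpow ?M) (\<lambda>t. ?l (C t))"
    unfolding diff_curve_def
  proof (intro conjI ballI)
    fix t assume t: "t \<in> {-\<epsilon>'<..<\<epsilon>'}"
    show "?l (C t) \<in> W \<inter> Mpow ?M"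
      using near[OF t] by blast
    obtain D where "(C has_derivative D) (at t)"
      using near[OF t] by (auto simp: differentiable_def)
    then show "(\<lambda>t. ?l (C t)) differentiable (at t)"
      using bounded_linear.has_derivative[OF bounded_linear_local_values]
      unfolding differentiable_def by blast
  qed (fact \<epsilon>')
  from has_vector_derivative_along_curve[OF L(1) this _ der]
  have "((\<lambda>t. interp S T (?l (C t)) ?\<xi>) has_vector_derivative L (?l b)) (at 0)"
    by (simp add: C(2))
  then have "((\<lambda>t. eval_inv S (C t) x) has_vector_derivative L (?l b)) (at 0)"
  proof (rule has_vector_derivative_transform_within_open)
    show "interp S T (?l (C t)) ?\<xi> = eval_inv S (C t) x" if "t \<in> {-\<epsilon>'<..<\<epsilon>'}" for t
      using near[OF that] by (intro eval_inv_eq_interp[symmetric] S T x unique) auto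
  qed (use \<epsilon>' in auto)
  then show ?thesis
    by (simp only: L(2))
qed

text \<open>The elementwise formulas for the test function agree where elements overlap, because each is
  the derivative of one globally defined curve of functions.\<close>

lemma test_fun_op_variation:
  assumes S: "gfe_setting S" and reg: "regular_interpolation S v"
    and C: "diff_curve \<epsilon> (alg_space S) C" "C 0 = v" "(C has_vector_derivative b) (at 0)"
    and b: "b \<in> tangent_Mpow (mfd S) v"
  shows "variation S (eval_inv S v) (test_fun_op S v b) (\<lambda>t. eval_inv S (C t))"
proof -
  let ?part = "\<lambda>T x. \<Sum>k\<in>ref_idx (ref S T).
      partial_interp S T k (local_values S T v) (ref_map S T x) (local_values S T b $ k)"
  let ?P = "\<lambda>\<eta>. \<eta> \<in> extensional (closure (dom\<Omega> S)) \<and> (\<forall>T\<in>grid S. \<forall>x\<in>T. \<eta> x = ?part T x)"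
  define \<eta> where "\<eta> = (\<lambda>x\<in>closure (dom\<Omega> S). vector_derivative (\<lambda>t. eval_inv S (C t) x) (at 0))"
  note der = has_vector_derivative_eval_inv[OF S reg C b]
  have sub: "x \<in> closure (dom\<Omega> S)" if "T \<in> grid S" "x \<in> T" for T x
    using that grid_cover[OF S] by blast
  have "\<eta> x = ?part T x" if "T \<in> grid S" "x \<in> T" for T x
    using vector_derivative_at[OF der[OF that]] sub[OF that] by (simp add: \<eta>_def)
  then have ex: "?P \<eta>"
    by (auto simp: \<eta>_def)
  have unique: "\<eta>' = \<eta>" if "?P \<eta>'" for \<eta>'
  proof (rule extensionalityI)
    fix x assume "x \<in> closure (dom\<Omega> S)"
    then obtain T where "T \<in> grid S" "x \<in> T"
      using grid_cover[OF S] by blast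
    then show "\<eta>' x = \<eta> x"
      using that ex by simp
  qed (use that ex in auto)
  from ex unique have "\<exists>!\<eta>. ?P \<eta>"
    by (rule ex1I)
  then have op: "?P (test_fun_op S v b)"
    unfolding test_fun_op_def by (rule theI')
  have "((\<lambda>t. eval_inv S (C t) x) has_vector_derivative test_fun_op S v b x) (at 0)"
    if x: "x \<in> closure (dom\<Omega> S)" for x
  proof -
    obtain T where T: "T \<in> grid S" "x \<in> T"
      using x grid_cover[OF S] by blast
    then show ?thesis
      using der[OF T] op by simp
  qed
  then show ?thesis
    using C(1,2) by (auto simp: variation_def Vh_curve_def)
qed

section \<open>The two differentials of the energy\<close>

text \<open>The nodes lie in the closure of the domain, where a variation is differentiable pointwise, and
  the values of \<open>c t\<close> at the nodes are the coefficients \<open>C t\<close>.\<close>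

lemma variation_nodal_derivative:
  assumes S: "gfe_setting S" and var: "variation S u \<eta> c"
    and C: "diff_curve \<epsilon> (alg_space S) C" "\<And>t. t \<in> {-\<epsilon><..<\<epsilon>} \<Longrightarrow> c t = eval_inv S (C t)"
  shows "(C has_vector_derivative eval_nodes S \<eta>) (at 0)"
proof -
  have "((\<lambda>t. \<chi> i. c t (node S i)) has_vector_derivative eval_nodes S \<eta>) (at 0)"
    using var node_in_closure[OF S]
    by (intro has_vector_derivative_vec_lambda) (auto simp: eval_nodes_def variation_def)
  moreover have "(\<chi> i. c t (node S i)) = C t" if t: "t \<in> {-\<epsilon><..<\<epsilon>}" for t
  proof -
    have "C t \<in> alg_space S"
      using C(1) t by (auto simp: diff_curve_def)
    from eval_inv_in_Vh(2)[OF this] show ?thesis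
      using C(2)[OF t] by (simp add: eval_nodes_def)
  qed
  ultimately show ?thesis
    using has_vector_derivative_transform_within_open[of _ _ 0 "{-\<epsilon><..<\<epsilon>}"] C(1)
    by (auto simp: diff_curve_def)
qed

text \<open>The derivative of the energy along a curve of finite element functions depends only on the
  field \<open>\<eta>\<close>, since evaluation at the nodes recovers the velocity of the coefficients from it.\<close>

lemma energy_derivative_along_variation:
  assumes S: "gfe_setting S" and v: "v \<in> alg_space S"
    and diff: "Vh_differentiable S \<J> (eval_inv S v)"
    and var: "variation S (eval_inv S v) \<eta> c"
  shows "((\<lambda>t. \<J> (c t)) has_real_derivative d_alg S \<J> v (eval_nodes S \<eta>)) (at 0)"
proof -
  obtain \<epsilon> C where C: "diff_curve \<epsilon> (alg_space S) C" "\<And>t. t \<in> {-\<epsilon><..<\<epsilon>} \<Longrightarrow> c t = eval_inv S (C t)"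
    using var by (auto simp: variation_def Vh_curve_def)
  have \<epsilon>: "0 < \<epsilon>" and C0_in: "C 0 \<in> alg_space S"
    using C(1) by (auto simp: diff_curve_def)
  have "eval_inv S (C 0) = eval_inv S v"
    using C(2)[of 0] var \<epsilon> by (simp add: variation_def)
  then have C0: "C 0 = v"
    using eval_inv_in_Vh(2)[OF C0_in] eval_inv_in_Vh(2)[OF v] by metis
  have "(alg_energy S \<J>) differentiable (at v within alg_space S)"
    using diff eval_inv_in_Vh(2)[OF v] by (simp add: Vh_differentiable_def alg_energy_def[abs_def])
  then have "(alg_energy S \<J> has_derivative d_alg S \<J> v) (at v within alg_space S)"
    by (simp add: d_alg_def frechet_derivative_works)
  from has_vector_derivative_along_curve[OF this C(1) C0 variation_nodal_derivative[OF S var C]]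
  have "((\<lambda>t. alg_energy S \<J> (C t)) has_vector_derivative d_alg S \<J> v (eval_nodes S \<eta>)) (at 0)"
    by simp
  then have "((\<lambda>t. \<J> (c t)) has_vector_derivative d_alg S \<J> v (eval_nodes S \<eta>)) (at 0)"
    by (rule has_vector_derivative_transform_within_open[of _ _ 0 "{-\<epsilon><..<\<epsilon>}"])
      (use \<epsilon> C(2) in \<open>auto simp: alg_energy_def\<close>)
  then show ?thesis
    by (simp add: has_real_derivative_iff_has_vector_derivative)
qed

text \<open>The definite description in \<open>d_energy\<close> needs some variation with the given test function; the
  one induced by a curve of coefficients with velocity \<open>b\<close> serves, and all others give the same
  derivative.\<close>

lemma d_energy_test_fun_op:
  assumes S: "gfe_setting S" and v: "v \<in> alg_space S" and reg: "regular_interpolation S v"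
    and diff: "Vh_differentiable S \<J> (eval_inv S v)"
    and b: "b \<in> tangent_Mpow (mfd S) v"
  shows "d_energy S \<J> (eval_inv S v) (test_fun_op S v b) = d_alg S \<J> v b"
proof -
  obtain \<epsilon> C where C: "diff_curve \<epsilon> (alg_space S) C" "C 0 = v" "(C has_vector_derivative b) (at 0)"
    using tangent_Mpow_curve[OF b openin_alg_space v] .
  note var = test_fun_op_variation[OF S reg C b]
  have "eval_nodes S (test_fun_op S v b) = b"
    using variation_nodal_derivative[OF S var C(1)] C(3) vector_derivative_unique_at by blast
  then have der: "((\<lambda>t. \<J> (c t)) has_real_derivative d_alg S \<J> v b) (at 0)"
    if "variation S (eval_inv S v) (test_fun_op S v b) c" for c
    using energy_derivative_along_variation[OF S v diff that] by simp
  show ?thesis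
    unfolding d_energy_def
  proof (rule the_equality)
    show "\<exists>c. variation S (eval_inv S v) (test_fun_op S v b) c \<and>
        ((\<lambda>t. \<J> (c t)) has_real_derivative d_alg S \<J> v b) (at 0)"
      using var der by blast
  qed (use der DERIV_unique in blast)
qed

theorem theorem4p1:
  fixes S :: "('d::finite, 'N::finite, 'n::finite, 'm::finite) gfe"
    and \<J> :: "(real ^ 'd \<Rightarrow> real ^ 'N) \<Rightarrow> real"
    and v :: "(real ^ 'N) ^ 'n"
  assumes "gfe_setting S"
    and "Vh S \<subseteq> H1_into (dom\<Omega> S) (mfd S)"
    and "functional_on_H1_into (dom\<Omega> S) (mfd S) \<J>"
    and "v \<in> alg_space S"
    and "regular_interpolation S v"
    and "Vh_differentiable S \<J> (eval_inv S v)"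
  shows "(\<forall>\<eta> \<in> tangent_Mpow (mfd S) v. d_alg S \<J> v \<eta> = 0) \<longleftrightarrow>
         (\<forall>\<eta> \<in> tangent_Mpow (mfd S) v. d_energy S \<J> (eval_inv S v) (test_fun_op S v \<eta>) = 0)"
  using d_energy_test_fun_op[OF assms(1,4-6)] by simp

end
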